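(* Let $(X,\cdot,\preceq)$ be a locally compact and order-connected topological po-group. Then the map $x\mapsto x^{\downarrow}$ topologically order-embeds $(X,\preceq)$ in $(\mathcal{C}(X),\subseteq)$, where $\mathcal{C}(X)$ is endowed with the Fell topology.
   Context: A po-group is a triple $(X,\cdot,\preceq)$ where $(X,\cdot)$ is a (not necessarily Abelian) group, $(X,\preceq)$ is a poset, and $x\preceq y$ implies $xz\preceq yz$ and $zx\preceq zy$ for all $x,y,z\in X$. A topological po-group is a po-group such that $X$ carries a topology making $(X,\cdot)$ a topological group and $\preceq$ a closed subset of $X\times X$ (so $X$ is Hausdorff). It is locally compact if $X$ is. For $x\in X$, $x^{\downarrow}:=\{z\in X:z\preceq x\}$ and $x^{\uparrow}:=\{z\in X:x\preceq z\}$. Order-connected means that $x^{\uparrow}\cap y^{\downarrow}$ is a connected subset of $X$ for all $x,y\in X$ with $x\preceq y$. $\mathcal{C}(X)$ is the set of all closed subsets of $X$ (including $\varnothing$), ordered by inclusion. The Fell topology on $\mathcal{C}(X)$ is generated (as a subbase) by all sets $\{A\in\mathcal{C}(X):A\cap O\neq\varnothing\}$ with $O\subseteq X$ open, and all sets $\{A\in\mathcal{C}(X):A\subseteq X\setminus K\}$ with $K\subseteq X$ compact. A map $\phi:(X_1,\preceq_1)\to(X_2,\preceq_2)$ topologically order-embeds if $x\preceq_1 y\iff\phi(x)\preceq_2\phi(y)$ for all $x,y\in X_1$ and $\phi$ is a homeomorphism from $X_1$ onto $\phi(X_1)$ with the subspace topology. *)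

theory Defs
  imports "HOL-Analysis.Analysis" "HOL-Algebra.Group"
begin

locale po_group = group G for G (structure) +
  fixes r :: "'a rel"
  assumes partial_order: "partial_order_on (carrier G) r"
    and translate_right:
      "\<lbrakk>(x, y) \<in> r; z \<in> carrier G\<rbrakk> \<Longrightarrow> (x \<otimes> z, y \<otimes> z) \<in> r"
    and translate_left:
      "\<lbrakk>(x, y) \<in> r; z \<in> carrier G\<rbrakk> \<Longrightarrow> (z \<otimes> x, z \<otimes> y) \<in> r"

locale topological_group = group G for G (structure) +
  fixes T :: "'a topology"
  assumes topspace_eq: "topspace T = carrier G"
    and continuous_mult: "continuous_map (prod_topology T T) T (\<lambda>(x, y). x \<otimes> y)"
    and continuous_inv: "continuous_map T T (\<lambda>x. inv x)"

locale topological_po_group = topological_group G T + po_group G r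
  for G (structure) and T r +
  assumes closed_order: "closedin (prod_topology T T) r"

text \<open>The down-set and the up-set of \<open>x\<close> are \<^term>\<open>under r x\<close> and \<^term>\<open>above r x\<close>.\<close>

definition order_connected :: "'a topology \<Rightarrow> 'a rel \<Rightarrow> bool"
  where "order_connected T r \<longleftrightarrow>
    (\<forall>x y. (x, y) \<in> r \<longrightarrow> connectedin T (above r x \<inter> under r y))"

definition closed_subsets :: "'a topology \<Rightarrow> 'a set set"
  where "closed_subsets T = {A. closedin T A}"

definition fell_topology :: "'a topology \<Rightarrow> 'a set topology"
  where "fell_topology T = topology_generated_by
    ({{A \<in> closed_subsets T. A \<inter> U \<noteq> {}} | U. openin T U} \<union>
     {{A \<in> closed_subsets T. A \<subseteq> topspace T - K} | K. compactin T K})"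

text \<open>\<^const>\<open>topology_generated_by\<close> takes the union of the subbase as the underlying space;
  here this is the whole hyperspace, because \<open>K\<close> may be empty.\<close>

lemma topspace_fell_topology: "topspace (fell_topology T) = closed_subsets T"
proof -
  have "closed_subsets T = {A \<in> closed_subsets T. A \<subseteq> topspace T - {}}"
    by (auto simp: closed_subsets_def dest: closedin_subset)
  moreover have "compactin T {}"
    by simp
  ultimately show ?thesis
    unfolding fell_topology_def topology_generated_by_topspace by blast
qed

definition topologically_order_embeds ::
    "'a topology \<Rightarrow> 'a rel \<Rightarrow> 'b topology \<Rightarrow> 'b rel \<Rightarrow> ('a \<Rightarrow> 'b) \<Rightarrow> bool"
  where "topologically_order_embeds T\<^sub>1 r\<^sub>1 T\<^sub>2 r\<^sub>2 \<phi> \<longleftrightarrow>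
    (\<forall>x\<in>topspace T\<^sub>1. \<forall>y\<in>topspace T\<^sub>1. (x, y) \<in> r\<^sub>1 \<longleftrightarrow> (\<phi> x, \<phi> y) \<in> r\<^sub>2) \<and>
    embedding_map T\<^sub>1 T\<^sub>2 \<phi>"

end

theory Submission
  imports Defs
begin

text \<open>
  That \<open>x \<preceq> y\<close> holds exactly when \<open>x\<^sup>\<down> \<subseteq> y\<^sup>\<down>\<close> is reflexivity and transitivity, so the substance
  is topological.

  \<^emph>\<open>Continuity.\<close> A down-set that meets an open \<open>U\<close> in a point \<open>z \<preceq> x\<close> goes on meeting \<open>U\<close> when \<open>x\<close>
  moves a little, because the point \<open>z x\<inverse> x' \<preceq> x'\<close> moves continuously along with \<open>x'\<close>; this is where
  the group structure enters. A down-set that misses a compact \<open>K\<close> goes on missing it because the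
  up-set of \<open>K\<close> is closed (lemma \<open>closedin_Image_compactin\<close>).

  \<^emph>\<open>Openness onto the image.\<close> Let \<open>W\<close> be a neighbourhood of \<open>x\<close>, and let \<open>U \<subseteq> W\<close> be a smaller open
  neighbourhood with compact frontier. If \<open>y\<^sup>\<down>\<close> contains a point \<open>z\<close> close to \<open>x\<close> while \<open>y\<close> is outside
  \<open>U\<close>, then the connected interval \<open>z\<^sup>\<up> \<inter> y\<^sup>\<down>\<close> crosses the frontier of \<open>U\<close> in a point that is above \<open>z\<close>,
  hence almost above \<open>x\<close>. No point of the frontier is both above and below \<open>x\<close>, so by compactness
  the frontier points above a small compact neighbourhood of \<open>x\<close> form a compact set that \<open>x\<^sup>\<down>\<close> misses.
  Missing that compact set and hitting the small neighbourhood is thus a Fell-open condition that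
  \<open>x\<^sup>\<down>\<close> satisfies and that forces \<open>y \<in> W\<close> (lemma \<open>lower_set_traps_point\<close>).
\<close>

section \<open>Closed relations and closed orders\<close>

text \<open>
  The image is the projection of \<open>r \<inter> (K \<times> Y)\<close> along the compact factor \<open>K\<close>, and such
  projections are closed maps.
\<close>

lemma closedin_Image_compactin:
  assumes closed: "closedin (prod_topology X Y) r" and K: "compactin X K"
  shows "closedin Y (r `` K)"
proof -
  have "K \<subseteq> topspace X"
    using K compactin_subset_topspace by blast
  moreover have "compact_space (subtopology X K)"
    using K compact_space_subtopology by blast
  moreover have "closedin (prod_topology (subtopology X K) Y) (r \<inter> K \<times> topspace Y)"
    using closed by (auto simp: prod_topology_subtopology closedin_subtopology)
  ultimately have "closedin Y (snd ` (r \<inter> K \<times> topspace Y))"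
    using closed_map_snd closed_map_def by blast
  moreover have "snd ` (r \<inter> K \<times> topspace Y) = r `` K"
    using closedin_subset[OF closed] by force
  ultimately show ?thesis
    by simp
qed

lemma closedin_converse:
  assumes "closedin (prod_topology X Y) r"
  shows "closedin (prod_topology Y X) (r\<inverse>)"
proof -
  have "continuous_map (prod_topology Y X) (prod_topology X Y) (\<lambda>p. (snd p, fst p))"
    by (intro continuous_intros)
  from closedin_continuous_map_preimage[OF this assms]
  have "closedin (prod_topology Y X)
      {p \<in> topspace (prod_topology Y X). (snd p, fst p) \<in> r}" .
  moreover have "{p \<in> topspace (prod_topology Y X). (snd p, fst p) \<in> r} = r\<inverse>"
    using closedin_subset[OF assms] by auto
  ultimately show ?thesis
    by simp
qed

lemma under_eq_Image: "under r x = r\<inverse> `` {x}"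
  by (auto simp: under_def)

lemma closedin_under:
  assumes "closedin (prod_topology T T) r" and "x \<in> topspace T"
  shows "closedin T (under r x)"
  unfolding under_eq_Image
  using assms by (intro closedin_Image_compactin closedin_converse) auto

text \<open>The diagonal is closed, since antisymmetry makes it the intersection of \<open>r\<close> with its converse.\<close>

lemma closed_order_imp_Hausdorff_space:
  assumes closed: "closedin (prod_topology T T) r"
    and po: "partial_order_on (topspace T) r"
  shows "Hausdorff_space T"
proof -
  have "antisym r" "refl_on (topspace T) r" "r \<subseteq> topspace T \<times> topspace T"
    using po closedin_subset[OF closed] by (simp_all add: partial_order_on_def preorder_on_def)
  then have "r \<inter> r\<inverse> = (\<lambda>x. (x, x)) ` topspace T"
    unfolding antisym_def refl_on_def by blast
  moreover have "closedin (prod_topology T T) (r \<inter> r\<inverse>)"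
    using closed closedin_converse by blast
  ultimately show ?thesis
    by (simp add: Hausdorff_space_closedin_diagonal)
qed

lemma under_subset_iff:
  assumes "partial_order_on A r" and "x \<in> A"
  shows "under r x \<subseteq> under r y \<longleftrightarrow> (x, y) \<in> r"
proof -
  have "(x, x) \<in> r" "trans r"
    using assms by (simp_all add: partial_order_on_def preorder_on_def refl_on_def)
  then show ?thesis
    unfolding under_def by (blast dest: transD)
qed

lemma inj_on_under:
  assumes po: "partial_order_on A r"
  shows "inj_on (under r) A"
proof (rule inj_onI)
  fix x y
  assume "x \<in> A" "y \<in> A" "under r x = under r y"
  then have "(x, y) \<in> r" "(y, x) \<in> r"
    using under_subset_iff[OF po] by blast+
  then show "x = y"
    using po by (auto simp: partial_order_on_def dest: antisymD)
qed


section \<open>Subbasic open sets of the Fell topology\<close>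

lemma openin_fell_hit:
  "openin T U \<Longrightarrow> openin (fell_topology T) {A \<in> closed_subsets T. A \<inter> U \<noteq> {}}"
  unfolding fell_topology_def by (rule topology_generated_by_Basis) blast

lemma openin_fell_miss:
  "compactin T K \<Longrightarrow> openin (fell_topology T) {A \<in> closed_subsets T. A \<subseteq> topspace T - K}"
  unfolding fell_topology_def by (rule topology_generated_by_Basis) blast

lemma continuous_map_fell_topologyI:
  assumes closed: "\<And>x. x \<in> topspace S \<Longrightarrow> closedin T (f x)"
    and hit: "\<And>U. openin T U \<Longrightarrow> openin S {x \<in> topspace S. f x \<inter> U \<noteq> {}}"
    and miss: "\<And>K. compactin T K \<Longrightarrow> openin S {x \<in> topspace S. f x \<inter> K = {}}"
  shows "continuous_map S (fell_topology T) f"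
proof -
  have image: "f ` topspace S \<subseteq> topspace (fell_topology T)"
    using closed by (auto simp: topspace_fell_topology closed_subsets_def)
  have sub: "f x \<subseteq> topspace T" if "x \<in> topspace S" for x
    using closed[OF that] by (rule closedin_subset)
  have hit': "f -` {A \<in> closed_subsets T. A \<inter> U \<noteq> {}} \<inter> topspace S
      = {x \<in> topspace S. f x \<inter> U \<noteq> {}}" for U
    using closed by (auto simp: closed_subsets_def)
  have miss': "f -` {A \<in> closed_subsets T. A \<subseteq> topspace T - K} \<inter> topspace S
      = {x \<in> topspace S. f x \<inter> K = {}}" for K
    using closed sub unfolding closed_subsets_def by blast
  show ?thesis
    unfolding fell_topology_def
  proof (rule continuous_on_generated_topo)
    fix \<U>
    assume "\<U> \<in> {{A \<in> closed_subsets T. A \<inter> U \<noteq> {}} |U. openin T U} \<union>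
                {{A \<in> closed_subsets T. A \<subseteq> topspace T - K} |K. compactin T K}"
    then consider
        U where "openin T U" "\<U> = {A \<in> closed_subsets T. A \<inter> U \<noteq> {}}"
      | K where "compactin T K" "\<U> = {A \<in> closed_subsets T. A \<subseteq> topspace T - K}"
      by blast
    then show "openin S (f -` \<U> \<inter> topspace S)"
    proof cases
      case 1
      then show ?thesis
        using hit hit' by simp
    next
      case 2
      then show ?thesis
        using miss miss' by simp
    qed
  next
    show "f ` topspace S \<subseteq> \<Union> ({{A \<in> closed_subsets T. A \<inter> U \<noteq> {}} |U. openin T U} \<union>
                {{A \<in> closed_subsets T. A \<subseteq> topspace T - K} |K. compactin T K})"
      using image unfolding fell_topology_def topology_generated_by_topspace .
  qed
qed


section \<open>Continuity of the down-set map\<close>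

lemma openin_under_misses_compactin:
  assumes closed: "closedin (prod_topology T T) r" and "compactin T K"
  shows "openin T {x \<in> topspace T. under r x \<inter> K = {}}"
proof -
  have "openin T (topspace T - r `` K)"
    using closedin_Image_compactin[OF assms] by blast
  moreover have "topspace T - r `` K = {x \<in> topspace T. under r x \<inter> K = {}}"
    by (auto simp: under_def)
  ultimately show ?thesis
    by simp
qed

lemma (in topological_po_group) openin_under_hits_openin:
  assumes "openin T U"
  shows "openin T {x \<in> topspace T. under r x \<inter> U \<noteq> {}}"
proof (subst openin_subopen, intro ballI)
  fix x
  assume "x \<in> {x \<in> topspace T. under r x \<inter> U \<noteq> {}}"
  then obtain z where x: "x \<in> topspace T" and z: "z \<in> under r x" "z \<in> U"
    by blast
  have xc: "x \<in> carrier G" and zc: "z \<in> carrier G"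
    using x z assms openin_subset topspace_eq by blast+
  \<comment> \<open>Left translation by \<open>c \<preceq> \<one>\<close> moves every \<open>y\<close> to a point below it, and it moves \<open>x\<close> to \<open>z\<close>.\<close>
  define c where "c = z \<otimes> inv x"
  have c: "c \<in> carrier G"
    using xc zc by (simp add: c_def)
  have "(z \<otimes> inv x, x \<otimes> inv x) \<in> r"
    using z xc by (intro translate_right) (auto simp: under_def)
  then have c_le: "(c, \<one>) \<in> r"
    using xc by (simp add: c_def)
  have "continuous_map T (prod_topology T T) (\<lambda>y. (c, y))"
    using c by (intro continuous_intros) (simp add: topspace_eq)
  from continuous_map_compose[OF this continuous_mult]
  have "continuous_map T T (\<lambda>y. c \<otimes> y)"
    by (simp add: o_def)
  then have "openin T {y \<in> topspace T. c \<otimes> y \<in> U}"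
    using assms openin_continuous_map_preimage by blast
  moreover have "c \<otimes> x \<in> U"
    using xc zc z(2) by (simp add: c_def m_assoc)
  moreover have "under r y \<inter> U \<noteq> {}" if "y \<in> topspace T" "c \<otimes> y \<in> U" for y
  proof -
    have "(c \<otimes> y, \<one> \<otimes> y) \<in> r"
      using that topspace_eq by (intro translate_right[OF c_le]) simp
    then show ?thesis
      using that topspace_eq by (auto simp: under_def)
  qed
  ultimately show "\<exists>V. openin T V \<and> x \<in> V \<and> V \<subseteq> {x \<in> topspace T. under r x \<inter> U \<noteq> {}}"
    using x by (intro exI[of _ "{y \<in> topspace T. c \<otimes> y \<in> U}"]) auto
qed

lemma (in topological_po_group) continuous_map_under:
  "continuous_map T (fell_topology T) (under r)"
  by (intro continuous_map_fell_topologyI closedin_under[OF closed_order]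
      openin_under_hits_openin openin_under_misses_compactin[OF closed_order])


section \<open>Openness of the down-set map onto its image\<close>

text \<open>
  Local compactness supplies compact frontiers, and order-connectedness keeps an interval from jumping
  across them: if \<open>y\<close> lies outside \<open>W\<close> while its down-set reaches into \<open>V\<close>, then that down-set
  meets the frontier at a point of \<open>K\<close>.
\<close>

lemma lower_set_traps_point:
  assumes closed: "closedin (prod_topology T T) r"
    and po: "partial_order_on (topspace T) r"
    and lc: "locally_compact_space T"
    and oc: "order_connected T r"
    and W: "openin T W" and xW: "x \<in> W"
  obtains V K where "openin T V" "compactin T K"
    "under r x \<inter> V \<noteq> {}" "under r x \<inter> K = {}"
    "\<And>y. \<lbrakk>under r y \<inter> V \<noteq> {}; under r y \<inter> K = {}\<rbrakk> \<Longrightarrow> y \<in> W"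
proof -
  have rfl: "\<And>a. a \<in> topspace T \<Longrightarrow> (a, a) \<in> r"
    and asym: "\<And>a b. \<lbrakk>(a, b) \<in> r; (b, a) \<in> r\<rbrakk> \<Longrightarrow> a = b"
    using po by (auto simp: partial_order_on_def preorder_on_def dest: refl_onD antisymD)
  have sub: "r \<subseteq> topspace T \<times> topspace T"
    using closedin_subset[OF closed] by simp
  have x: "x \<in> topspace T"
    using W xW openin_subset by blast
  have "neighbourhood_base_of (\<lambda>C. compactin T C \<and> closedin T C) T"
    using lc closed_order_imp_Hausdorff_space[OF closed po]
      locally_compact_space_neighbourhood_base_closedin by blast
  then have nbhd: "\<exists>U C. openin T U \<and> (compactin T C \<and> closedin T C) \<and> x \<in> U \<and> U \<subseteq> C \<and> C \<subseteq> O'"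
    if "openin T O'" "x \<in> O'" for O'
    using that unfolding neighbourhood_base_of by blast
  obtain U C where U: "openin T U" "x \<in> U" "U \<subseteq> W" and C: "compactin T C" "closedin T C" "U \<subseteq> C"
    using nbhd[OF W xW] by blast
  define F where "F = T frontier_of U"
  have "F \<subseteq> C"
    using closure_of_minimal[OF C(3,2)] unfolding F_def frontier_of_def by blast
  then have F: "compactin T F"
    using closed_compactin[OF C(1)] by (simp add: F_def closedin_frontier_of)
  have xF: "x \<notin> F"
    using U by (simp add: F_def frontier_of_def interior_of_openin)

  \<comment> \<open>The frontier points below \<open>x\<close> form a compact set, so its down-closure is closed; by antisymmetry
     \<open>x\<close> is not in that down-closure, and hence some compact neighbourhood \<open>L\<close> of \<open>x\<close> avoids it.\<close>
  have "compactin T (under r x \<inter> F)"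
    using closedin_under[OF closed x] F by (rule closed_Int_compactin)
  then have closed_below: "closedin T (r\<inverse> `` (under r x \<inter> F))"
    using closedin_Image_compactin closedin_converse[OF closed] by blast
  define N where "N = topspace T - r\<inverse> `` (under r x \<inter> F)"
  have "openin T N"
    unfolding N_def using closed_below by blast
  moreover have "x \<in> N"
    using x xF asym unfolding N_def under_def by blast
  ultimately obtain V' L where V': "openin T V'" "x \<in> V'" "V' \<subseteq> L" and L: "compactin T L"
    and "L \<subseteq> N"
    using nbhd[of N] by blast
  then have L_avoids: "L \<inter> r\<inverse> `` (under r x \<inter> F) = {}"
    unfolding N_def by blast
  define V where "V = U \<inter> V'"
  define K where "K = r `` L \<inter> F"
  show thesis
  proof
    show "openin T V"
      using U V' by (auto simp: V_def)
    show "compactin T K"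
      unfolding K_def using closedin_Image_compactin[OF closed L] F by (rule closed_Int_compactin)
    show "under r x \<inter> V \<noteq> {}"
      using U V' rfl[OF x] by (auto simp: V_def under_def)
    show "under r x \<inter> K = {}"
      using L_avoids by (auto simp: K_def)
  next
    fix y
    assume "under r y \<inter> V \<noteq> {}" and miss: "under r y \<inter> K = {}"
    then obtain z where zy: "(z, y) \<in> r" and z: "z \<in> U" "z \<in> L"
      using V' by (auto simp: V_def under_def)
    define I where "I = above r z \<inter> under r y"
    have conn: "connectedin T I"
      using oc zy by (auto simp: order_connected_def I_def)
    have zI: "z \<in> I" and yI: "y \<in> I"
      using zy rfl sub unfolding I_def above_def under_def by blast+
    have "I \<inter> F = {}"
      using miss z by (auto simp: I_def K_def above_def)
    then have "I - U = {}"
      using connectedin_Int_frontier_of[OF conn, of U] zI z by (auto simp: F_def)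
    then show "y \<in> W"
      using yI U by blast
  qed
qed

lemma open_map_under:
  assumes closed: "closedin (prod_topology T T) r"
    and po: "partial_order_on (topspace T) r"
    and lc: "locally_compact_space T"
    and oc: "order_connected T r"
  shows "open_map T (subtopology (fell_topology T) (under r ` topspace T)) (under r)"
  unfolding open_map_def
proof (intro allI impI, subst openin_subopen, intro ballI)
  fix W A
  assume "openin T W" and "A \<in> under r ` W"
  then obtain x where W: "openin T W" "x \<in> W" and A: "A = under r x"
    by blast
  let ?Y = "subtopology (fell_topology T) (under r ` topspace T)"
  obtain V K where VK: "openin T V" "compactin T K"
    "under r x \<inter> V \<noteq> {}" "under r x \<inter> K = {}"
    "\<And>y. \<lbrakk>under r y \<inter> V \<noteq> {}; under r y \<inter> K = {}\<rbrakk> \<Longrightarrow> y \<in> W"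
    using lower_set_traps_point[OF assms W] by metis
  define \<V> where "\<V> = {A \<in> closed_subsets T. A \<inter> V \<noteq> {}}
    \<inter> {A \<in> closed_subsets T. A \<subseteq> topspace T - K}"
  have "openin (fell_topology T) \<V>"
    unfolding \<V>_def using VK by (intro openin_Int openin_fell_hit openin_fell_miss)
  then have "openin ?Y (\<V> \<inter> under r ` topspace T)"
    unfolding openin_subtopology by blast
  moreover have "x \<in> topspace T"
    using W openin_subset by blast
  moreover have "under r x \<in> \<V>"
  proof -
    have "closedin T (under r x)"
      using \<open>x \<in> topspace T\<close> by (rule closedin_under[OF closed])
    moreover from this have "under r x \<subseteq> topspace T"
      by (rule closedin_subset)
    ultimately show ?thesis
      using VK(3,4) unfolding \<V>_def closed_subsets_def by blast
  qed
  moreover have "\<V> \<inter> under r ` topspace T \<subseteq> under r ` W"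
    using VK(5) by (auto simp: \<V>_def)
  ultimately show "\<exists>\<O>. openin ?Y \<O> \<and> A \<in> \<O> \<and> \<O> \<subseteq> under r ` W"
    unfolding A by blast
qed


section \<open>The embedding\<close>

theorem theorem28:
  fixes G :: "('a, 'b) monoid_scheme" and T :: "'a topology" and r :: "'a rel"
  assumes "topological_po_group G T r"
    and "locally_compact_space T"
    and "order_connected T r"
  shows "topologically_order_embeds T r
    (fell_topology T) (relation_of (\<subseteq>) (closed_subsets T)) (\<lambda>x. under r x)"
proof -
  interpret topological_po_group G T r
    by (rule assms)
  have po: "partial_order_on (topspace T) r"
    using partial_order by (simp add: topspace_eq)
  let ?Y = "subtopology (fell_topology T) (under r ` topspace T)"
  have closed: "under r x \<in> closed_subsets T" if "x \<in> topspace T" for x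
    using closedin_under[OF closed_order that] by (simp add: closed_subsets_def)
  have "(x, y) \<in> r \<longleftrightarrow> (under r x, under r y) \<in> relation_of (\<subseteq>) (closed_subsets T)"
    if "x \<in> topspace T" "y \<in> topspace T" for x y
    using that closed under_subset_iff[OF po] by (auto simp: relation_of_def)
  moreover have "homeomorphic_map T ?Y (under r)"
  proof (rule bijective_open_imp_homeomorphic_map)
    show "continuous_map T ?Y (under r)"
      using continuous_map_under by (simp add: continuous_map_in_subtopology)
    show "open_map T ?Y (under r)"
      using open_map_under[OF closed_order po assms(2,3)] .
    show "under r ` topspace T = topspace ?Y"
      using closed by (auto simp: topspace_fell_topology)
    show "inj_on (under r) (topspace T)"
      using inj_on_under[OF po] .
  qed
  ultimately show ?thesis
    by (auto simp: topologically_order_embeds_def embedding_map_def)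
qed

end
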